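(* Let $\mathcal{H}$ be a separable infinite dimensional complex Hilbert space. Then there exists a compact quasinilpotent operator $T\in L(\mathcal{H})$ for which $\Sigma(T)=\{1\}$.
   Context: All vector spaces are over $\mathbb{C}$. For a Banach space $\mathcal{B}$, $L(\mathcal{B})$ is the algebra of bounded linear operators on $\mathcal{B}$. A complex number $\lambda$ is called an extended eigenvalue of $T\in L(\mathcal{B})$ if there exists a non-zero $X\in L(\mathcal{B})$ such that $XT=\lambda TX$. The set of all extended eigenvalues of $T$ is denoted $\Sigma(T)$. An operator is quasinilpotent if its spectrum is $\{0\}$. *)

theory Defs
  imports "HOL-Analysis.Analysis"
begin

class complex_vector = real_vector +
  fixes scaleC :: "complex \<Rightarrow> 'a \<Rightarrow> 'a" (infixr \<open>*\<^sub>C\<close> 75)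
  assumes scaleC_add_right: "a *\<^sub>C (x + y) = a *\<^sub>C x + a *\<^sub>C y"
    and scaleC_add_left: "(a + b) *\<^sub>C x = a *\<^sub>C x + b *\<^sub>C x"
    and scaleC_scaleC: "a *\<^sub>C (b *\<^sub>C x) = (a * b) *\<^sub>C x"
    and scaleC_of_real: "complex_of_real r *\<^sub>C x = r *\<^sub>R x"

class complex_normed_vector = complex_vector + real_normed_vector +
  assumes norm_scaleC: "norm (a *\<^sub>C x) = cmod a * norm x"

text \<open>Linear in the first argument; definiteness follows from \<open>cinner_same\<close>.\<close>

class complex_inner = complex_normed_vector +
  fixes cinner :: "'a \<Rightarrow> 'a \<Rightarrow> complex"
  assumes cinner_add_left: "cinner (x + y) z = cinner x z + cinner y z"
    and cinner_scaleC_left: "cinner (a *\<^sub>C x) y = a * cinner x y"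
    and cinner_commute: "cinner y x = cnj (cinner x y)"
    and cinner_same: "cinner x x = complex_of_real ((norm x)\<^sup>2)"

class chilbert_space = complex_inner + complete_space

global_interpretation complex_vector:
  vector_space "scaleC :: complex \<Rightarrow> 'a \<Rightarrow> 'a::complex_vector"
  defines cspan = complex_vector.span
proof
  fix x :: 'a
  show "1 *\<^sub>C x = x"
    using scaleC_of_real[of 1 x] by simp
qed (fact scaleC_add_right scaleC_add_left scaleC_scaleC)+

definition finite_cdim :: "'a::complex_vector set \<Rightarrow> bool" where
  "finite_cdim S \<longleftrightarrow> (\<exists>B. finite B \<and> cspan B = S)"

definition bounded_clinear :: "('a::complex_normed_vector \<Rightarrow> 'b::complex_normed_vector) \<Rightarrow> bool" where
  "bounded_clinear T \<longleftrightarrow> bounded_linear T \<and> (\<forall>a x. T (a *\<^sub>C x) = a *\<^sub>C T x)"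

definition compact_operator :: "('a::complex_normed_vector \<Rightarrow> 'b::complex_normed_vector) \<Rightarrow> bool" where
  "compact_operator T \<longleftrightarrow>
     bounded_clinear T \<and> (\<forall>S. bounded S \<longrightarrow> compact (closure (T ` S)))"

definition invertible_operator :: "('a::complex_normed_vector \<Rightarrow> 'a) \<Rightarrow> bool" where
  "invertible_operator T \<longleftrightarrow>
     bounded_clinear T \<and> (\<exists>S. bounded_clinear S \<and> S \<circ> T = id \<and> T \<circ> S = id)"

definition spectrum :: "('a::complex_normed_vector \<Rightarrow> 'a) \<Rightarrow> complex set" where
  "spectrum T = {\<mu>. \<not> invertible_operator (\<lambda>x. T x - \<mu> *\<^sub>C x)}"

definition quasinilpotent :: "('a::complex_normed_vector \<Rightarrow> 'a) \<Rightarrow> bool" where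
  "quasinilpotent T \<longleftrightarrow> spectrum T = {0}"

definition extended_eigenvalue :: "('a::complex_normed_vector \<Rightarrow> 'a) \<Rightarrow> complex \<Rightarrow> bool" where
  "extended_eigenvalue T \<mu> \<longleftrightarrow>
     (\<exists>X. bounded_clinear X \<and> X \<noteq> (\<lambda>_. 0) \<and> X \<circ> T = (\<lambda>x. \<mu> *\<^sub>C T (X x)))"

definition extended_eigenvalues :: "('a::complex_normed_vector \<Rightarrow> 'a) \<Rightarrow> complex set" where
  "extended_eigenvalues T = {\<mu>. extended_eigenvalue T \<mu>}"

end

theory Submission
  imports Defs
begin

text \<open>Let \<open>e\<close> be an orthonormal basis. The operator is a weighted backward shift with a second
  term, \<open>T e\<^sub>n = w\<^sub>n e\<^bsub>n-1\<^esub> + a\<^sub>n e\<^bsub>n-2\<^esub>\<close>, where \<open>a\<^sub>n\<close> is nonzero only at the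
  jumps \<open>n = 4, 16, 64, \<dots>\<close>. Both weights are at most \<open>2\<^sup>-\<^sup>n\<close>, which makes \<open>T\<close> nuclear, hence compact
  (\<open>compact_operator_T\<close>), and \<open>T\<close> is strictly triangular, so that its powers decrease faster than
  geometrically and the Neumann series inverts \<open>T - \<mu>\<close> for every \<open>\<mu> \<noteq> 0\<close>
  (\<open>invertible_operator_if_strictly_triangular\<close>).

  For a plain weighted shift \<open>S\<close> the diagonal matrix \<open>D\<close> with entries \<open>\<mu>\<^sup>-\<^sup>r\<close> satisfies
  \<open>D S = \<mu> S D\<close>, and so do the products \<open>S\<^sup>m D\<close>. A jump lowers the index by two, and there \<open>D\<close>
  would produce \<open>\<mu>\<^sup>2\<close> instead of \<open>\<mu>\<close>. Now let \<open>X T = \<mu> T X\<close> with \<open>X \<noteq> 0\<close>. The case \<open>\<mu> = 0\<close> is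
  impossible because \<open>T\<close> has dense range (\<open>eq_0_if_multiplier_0\<close>). Otherwise let \<open>m\<close> be least with
  \<open>X e\<^sub>m \<noteq> 0\<close>. Then \<open>X\<close> lowers indices by at least \<open>m\<close>, and its first nonzero diagonal is that of a
  multiple of \<open>S\<^sup>m D\<close> (\<open>entry_eq_0\<close>, \<open>entry_diagonal\<close>). At a jump \<open>n\<close> the two sides of
  \<open>X T\<^sup>m\<^sup>+\<^sup>1 = \<mu>\<^sup>m\<^sup>+\<^sup>1 T\<^sup>m\<^sup>+\<^sup>1 X\<close> then differ by a diagonal term proportional to
  \<open>(\<mu> - 1) a\<^sub>n\<close>, which can only be compensated by other entries of \<open>X\<close> multiplied by \<open>w\<^sub>n\<close> or
  \<open>w\<^bsub>n-1\<^esub>\<close> (\<open>jump_relation\<close>). These two weights are at most \<open>2\<close> to the power \<open>-(n-1)\<^sup>2\<close>, whereas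
  \<open>a\<^sub>n\<close>, \<open>\<mu>\<^sup>n\<close> and the products of \<open>m\<close> weights near \<open>n\<close> change only exponentially in \<open>n\<close>. For
  \<open>\<mu> \<noteq> 1\<close> the entries of \<open>X\<close> would thus be unbounded (\<open>multiplier_eq_1\<close>).\<close>

section \<open>Bounded complex-linear operators\<close>

instance chilbert_space \<subseteq> banach ..

lemma bounded_bilinear_scaleC:
  "bounded_bilinear (scaleC :: complex \<Rightarrow> 'a::complex_normed_vector \<Rightarrow> 'a)"
proof
  fix a a' :: complex and b b' :: 'a and r :: real
  show "(a + a') *\<^sub>C b = a *\<^sub>C b + a' *\<^sub>C b" by (rule scaleC_add_left)
  show "a *\<^sub>C (b + b') = a *\<^sub>C b + a *\<^sub>C b'" by (rule scaleC_add_right)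
  show "(r *\<^sub>R a) *\<^sub>C b = r *\<^sub>R (a *\<^sub>C b)"
    by (simp add: scaleR_conv_of_real scaleC_scaleC flip: scaleC_of_real)
  show "a *\<^sub>C (r *\<^sub>R b) = r *\<^sub>R (a *\<^sub>C b)"
    by (simp add: scaleC_scaleC mult.commute flip: scaleC_of_real)
  show "\<exists>K. \<forall>a b. norm (a *\<^sub>C b :: 'a) \<le> norm a * norm b * K"
    by (intro exI[of _ 1]) (simp add: norm_scaleC)
qed

lemmas scaleC_zero_left [simp] = bounded_bilinear.zero_left[OF bounded_bilinear_scaleC]
lemmas scaleC_zero_right [simp] = bounded_bilinear.zero_right[OF bounded_bilinear_scaleC]
lemmas scaleC_minus_left = bounded_bilinear.minus_left[OF bounded_bilinear_scaleC]
lemmas scaleC_diff_right = bounded_bilinear.diff_right[OF bounded_bilinear_scaleC]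

lemma bounded_clinearI:
  assumes "\<And>x y. T (x + y) = T x + T y" "\<And>a x. T (a *\<^sub>C x) = a *\<^sub>C T x"
    and "\<And>x. norm (T x) \<le> norm x * K"
  shows "bounded_clinear T"
proof -
  have "T (r *\<^sub>R x) = r *\<^sub>R T x" for r x
    using assms(2)[of "of_real r" x] by (simp add: scaleC_of_real)
  then show ?thesis
    unfolding bounded_clinear_def using assms by (auto intro!: bounded_linear_intro[where K = K])
qed

lemma bounded_clinear_linear: "bounded_clinear T \<Longrightarrow> bounded_linear T"
  by (simp add: bounded_clinear_def)

lemma bounded_clinear_scaleC: "bounded_clinear T \<Longrightarrow> T (a *\<^sub>C x) = a *\<^sub>C T x"
  by (simp add: bounded_clinear_def)

lemma bounded_clinear_id: "bounded_clinear (\<lambda>x. x)"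
  by (simp add: bounded_clinear_def bounded_linear_ident)

lemma bounded_clinear_funpow:
  fixes T :: "'a::complex_normed_vector \<Rightarrow> 'a"
  assumes "bounded_clinear T"
  shows "bounded_clinear (T ^^ k)"
proof (induction k)
  case (Suc k)
  then show ?case
    using assms bounded_linear_compose[of T "T ^^ k"] by (simp add: bounded_clinear_def o_def)
qed (simp add: bounded_clinear_def id_def bounded_linear_ident)

lemma bounded_clinear_diff_scaleC:
  assumes "bounded_clinear T"
  shows "bounded_clinear (\<lambda>x. T x - \<mu> *\<^sub>C x)"
  unfolding bounded_clinear_def
proof (intro conjI allI)
  show "bounded_linear (\<lambda>x. T x - \<mu> *\<^sub>C x)"
    by (intro bounded_linear_sub bounded_clinear_linear[OF assms]
        bounded_bilinear.bounded_linear_right[OF bounded_bilinear_scaleC])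
qed (simp add: bounded_clinear_scaleC[OF assms] scaleC_scaleC scaleC_diff_right mult.commute)

text \<open>The inverse of \<open>T - \<mu>\<close> is the Neumann series, summed from bounds on the powers
  of \<open>T\<close> rather than on \<open>T\<close> itself.\<close>

lemma invertible_operator_if_powers_summable:
  fixes T :: "'a::{complex_normed_vector, banach} \<Rightarrow> 'a"
  assumes T: "bounded_clinear T" and "\<mu> \<noteq> 0"
    and M: "\<And>k x. norm ((T ^^ k) x) \<le> M k * norm x"
    and sumM: "summable (\<lambda>k. M k / cmod \<mu> ^ k)"
  shows "invertible_operator (\<lambda>x. T x - \<mu> *\<^sub>C x)"
proof -
  interpret sc: bounded_bilinear "scaleC :: complex \<Rightarrow> 'a \<Rightarrow> 'a" by (rule bounded_bilinear_scaleC)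
  interpret T: bounded_linear T by (rule bounded_clinear_linear[OF T])
  note pow = bounded_clinear_funpow[OF T]
  note lin = bounded_clinear_linear[OF pow]
  define b where "b k x = (1 / \<mu>) ^ k *\<^sub>C (T ^^ k) x" for k x
  have nb: "norm (b k x) \<le> (M k / cmod \<mu> ^ k) * norm x" for k x
  proof -
    have "norm (b k x) = norm ((T ^^ k) x) / cmod \<mu> ^ k"
      by (simp add: b_def norm_scaleC norm_power norm_divide power_one_over)
    also have "\<dots> \<le> (M k * norm x) / cmod \<mu> ^ k"
      using M by (intro divide_right_mono) auto
    finally show ?thesis by simp
  qed
  have snb: "summable (\<lambda>k. norm (b k x))" for x
    by (rule summable_comparison_test'[OF summable_mult2[OF sumM, of "norm x"], of 0]) (use nb in auto)
  have sb: "summable (\<lambda>k. b k x)" for x by (rule summable_norm_cancel[OF snb])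
  define R where "R x = (\<Sum>k. b k x)" for x
  have R: "bounded_clinear R"
  proof (rule bounded_clinearI)
    fix x y :: 'a and a :: complex
    have "b k (x + y) = b k x + b k y" for k
      by (simp add: b_def linear_simps(1)[OF lin] sc.add_right)
    then show "R (x + y) = R x + R y" by (simp add: R_def suminf_add[OF sb sb])
    have "b k (a *\<^sub>C x) = a *\<^sub>C b k x" for k
      by (simp add: b_def bounded_clinear_scaleC[OF pow] scaleC_scaleC mult.commute)
    then show "R (a *\<^sub>C x) = a *\<^sub>C R x"
      by (simp add: R_def bounded_linear.suminf[OF sc.bounded_linear_right sb])
    have "norm (R x) \<le> (\<Sum>k. norm (b k x))" unfolding R_def by (rule summable_norm[OF snb])
    also have "\<dots> \<le> (\<Sum>k. (M k / cmod \<mu> ^ k) * norm x)"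
      by (intro suminf_le nb snb summable_mult2 sumM)
    also have "\<dots> = norm x * (\<Sum>k. M k / cmod \<mu> ^ k)"
      by (subst suminf_mult2[OF sumM, symmetric]) (rule mult.commute)
    finally show "norm (R x) \<le> norm x * (\<Sum>k. M k / cmod \<mu> ^ k)" .
  qed
  interpret R: bounded_linear R by (rule bounded_clinear_linear[OF R])
  have commute: "R (T x) = T (R x)" for x
  proof -
    have "b k (T x) = T (b k x)" for k
      by (simp add: b_def funpow_swap1 bounded_clinear_scaleC[OF T])
    then show ?thesis by (simp add: R_def T.suminf[OF sb])
  qed
  have telescope: "\<mu> *\<^sub>C R x - T (R x) = \<mu> *\<^sub>C x" for x
  proof -
    have "T (b k x) = \<mu> *\<^sub>C b (Suc k) x" for k
      using \<open>\<mu> \<noteq> 0\<close> by (simp add: b_def bounded_clinear_scaleC[OF T] scaleC_scaleC)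
    then have "T (R x) = (\<Sum>k. \<mu> *\<^sub>C b (Suc k) x)" by (simp add: R_def T.suminf[OF sb])
    also have "\<dots> = \<mu> *\<^sub>C (\<Sum>k. b (Suc k) x)"
      by (rule bounded_linear.suminf[OF sc.bounded_linear_right, symmetric])
        (subst summable_Suc_iff, rule sb)
    also have "(\<Sum>k. b (Suc k) x) = R x - x"
      using suminf_split_head[OF sb[of x]] complex_vector.scale_one by (simp add: R_def b_def)
    finally show ?thesis by (simp add: scaleC_diff_right)
  qed
  define S where "S x = (- (1 / \<mu>)) *\<^sub>C R x" for x
  have cancel: "(- (1 / \<mu>)) *\<^sub>C (\<mu> *\<^sub>C x) = - x" for x :: 'a
    using \<open>\<mu> \<noteq> 0\<close> by (simp add: scaleC_scaleC scaleC_minus_left)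
  have "bounded_clinear S"
    unfolding bounded_clinear_def S_def
  proof (intro conjI allI)
    show "bounded_linear (\<lambda>x. (- (1 / \<mu>)) *\<^sub>C R x)"
      by (rule bounded_linear_compose[OF sc.bounded_linear_right R.bounded_linear_axioms])
  qed (simp add: bounded_clinear_scaleC[OF R] scaleC_scaleC mult.commute)
  moreover have "S (T x - \<mu> *\<^sub>C x) = x" for x
  proof -
    have "R (T x - \<mu> *\<^sub>C x) = - (\<mu> *\<^sub>C x)"
      using telescope[of x] by (simp add: R.diff commute bounded_clinear_scaleC[OF R] algebra_simps)
    then show ?thesis using cancel[of x] by (simp add: S_def sc.minus_right)
  qed
  moreover have "T (S x) - \<mu> *\<^sub>C S x = x" for x
  proof -
    have "T (S x) - \<mu> *\<^sub>C S x = (- (1 / \<mu>)) *\<^sub>C (T (R x) - \<mu> *\<^sub>C R x)"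
      unfolding S_def scaleC_diff_right bounded_clinear_scaleC[OF T] by (simp add: scaleC_scaleC)
    also have "T (R x) - \<mu> *\<^sub>C R x = - (\<mu> *\<^sub>C x)"
      using telescope[of x] by (simp add: algebra_simps)
    finally show ?thesis using cancel[of x] by (simp add: sc.minus_right)
  qed
  ultimately show ?thesis
    unfolding invertible_operator_def
    by (intro conjI bounded_clinear_diff_scaleC[OF T] exI[of _ S]) (auto simp: fun_eq_iff)
qed

section \<open>Nuclear operators\<close>

locale nuclear =
  fixes f :: "nat \<Rightarrow> 'a::{complex_normed_vector, banach} \<Rightarrow> complex" and v :: "nat \<Rightarrow> 'a"
  assumes f_add: "f n (x + y) = f n x + f n y"
    and f_scaleC: "f n (a *\<^sub>C x) = a * f n x"
    and f_bound: "cmod (f n x) \<le> norm x"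
    and summable_v: "summable (\<lambda>n. norm (v n))"
begin

definition T :: "'a \<Rightarrow> 'a" where
  "T x = (\<Sum>n. f n x *\<^sub>C v n)"

lemma norm_term: "norm (f n x *\<^sub>C y) \<le> norm x * norm y" for y :: 'a
  unfolding norm_scaleC by (intro mult_right_mono f_bound norm_ge_zero)

lemma summable_norm_term: "summable (\<lambda>n. norm (f n x *\<^sub>C v n))"
  by (rule summable_comparison_test'[OF summable_mult[OF summable_v, of "norm x"], of 0])
    (use norm_term in auto)

lemma summable_term: "summable (\<lambda>n. f n x *\<^sub>C v n)"
  by (rule summable_norm_cancel[OF summable_norm_term])

lemma bounded_clinear_T: "bounded_clinear T"
proof (rule bounded_clinearI)
  fix x y :: 'a and a :: complex
  show "T (x + y) = T x + T y"
    by (simp add: T_def f_add scaleC_add_left suminf_add[OF summable_term summable_term])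
  have "T (a *\<^sub>C x) = (\<Sum>n. a *\<^sub>C (f n x *\<^sub>C v n))"
    by (simp add: T_def f_scaleC scaleC_scaleC)
  also have "\<dots> = a *\<^sub>C T x"
    unfolding T_def
    by (rule bounded_linear.suminf[OF bounded_bilinear.bounded_linear_right
          [OF bounded_bilinear_scaleC] summable_term, symmetric])
  finally show "T (a *\<^sub>C x) = a *\<^sub>C T x" .
  have "norm (T x) \<le> (\<Sum>n. norm (f n x *\<^sub>C v n))"
    unfolding T_def by (rule summable_norm[OF summable_norm_term])
  also have "\<dots> \<le> (\<Sum>n. norm x * norm (v n))"
    by (intro suminf_le norm_term summable_norm_term summable_mult summable_v)
  also have "\<dots> = norm x * (\<Sum>n. norm (v n))"
    by (rule suminf_mult[OF summable_v])
  finally show "norm (T x) \<le> norm x * (\<Sum>n. norm (v n))" .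
qed

lemma tail_tendsto_0: "(\<lambda>k. \<Sum>n. norm (v (n + k))) \<longlonglongrightarrow> 0"
  using suminf_exist_split2[OF summable_v] .

text \<open>The image of a ball is totally bounded: the first \<open>N\<close> terms range over a compact set with
  finitely many complex parameters, and the remaining terms are uniformly small.\<close>

lemma compact_operator_T: "compact_operator T"
  unfolding compact_operator_def
proof (intro conjI allI impI bounded_clinear_T)
  fix S :: "'a set"
  assume "bounded S"
  then obtain r where r: "\<And>x. x \<in> S \<Longrightarrow> norm x \<le> r" "r > 0"
    using bounded_pos by metis
  define K where "K N = {\<Sum>n<N. c n *\<^sub>C v n | c. \<forall>n<N. cmod (c n) \<le> r}" for N :: nat
  have compact_K: "compact (K N)" for N
  proof (induction N)
    case (Suc N)
    have "compact ((\<lambda>c. c *\<^sub>C v N) ` cball 0 r)"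
      by (intro compact_continuous_image compact_cball linear_continuous_on
          bounded_bilinear.bounded_linear_left[OF bounded_bilinear_scaleC])
    from compact_sums[OF Suc this]
    have "compact {x + y | x y. x \<in> K N \<and> y \<in> (\<lambda>c. c *\<^sub>C v N) ` cball 0 r}" .
    also have "{x + y | x y. x \<in> K N \<and> y \<in> (\<lambda>c. c *\<^sub>C v N) ` cball 0 r} = K (Suc N)"
    proof (intro equalityI subsetI)
      fix z assume "z \<in> {x + y | x y. x \<in> K N \<and> y \<in> (\<lambda>c. c *\<^sub>C v N) ` cball 0 r}"
      then obtain c d where *: "\<forall>n<N. cmod (c n) \<le> r" "cmod d \<le> r"
          "z = (\<Sum>n<N. c n *\<^sub>C v n) + d *\<^sub>C v N"
        by (auto simp: K_def)
      have "z = (\<Sum>n<Suc N. (c(N := d)) n *\<^sub>C v n)" using * by simp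
      moreover have "\<forall>n<Suc N. cmod ((c(N := d)) n) \<le> r" using * by (auto simp: less_Suc_eq)
      ultimately show "z \<in> K (Suc N)" unfolding K_def by blast
    next
      fix z assume "z \<in> K (Suc N)"
      then show "z \<in> {x + y | x y. x \<in> K N \<and> y \<in> (\<lambda>c. c *\<^sub>C v N) ` cball 0 r}"
        by (fastforce simp: K_def)
    qed
    finally show ?case .
  qed (simp add: K_def)
  have "\<exists>k. finite k \<and> closure (T ` S) \<subseteq> (\<Union>x\<in>k. ball x \<epsilon>)" if "\<epsilon> > 0" for \<epsilon>
  proof -
    have "\<forall>\<^sub>F N in sequentially. (\<Sum>n. norm (v (n + N))) < \<epsilon> / (3 * r)"
      using order_tendstoD(2)[OF tail_tendsto_0, of "\<epsilon> / (3 * r)"] that r by simp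
    then obtain N where N: "(\<Sum>n. norm (v (n + N))) < \<epsilon> / (3 * r)"
      by (auto simp: eventually_sequentially)
    have "\<exists>k. finite k \<and> K N \<subseteq> (\<Union>x\<in>k. ball x (\<epsilon> / 3))"
      using compact_K[of N, unfolded compact_eq_totally_bounded, THEN conjunct2, rule_format,
          of "\<epsilon> / 3"] that by simp
    then obtain k where k: "finite k" "K N \<subseteq> (\<Union>x\<in>k. ball x (\<epsilon> / 3))" by blast
    have near: "\<exists>y\<in>k. dist y (T x) < 2 * \<epsilon> / 3" if "x \<in> S" for x
    proof -
      define s where "s = (\<Sum>n<N. f n x *\<^sub>C v n)"
      have "s \<in> K N"
        unfolding s_def K_def using order_trans[OF f_bound r(1)[OF that]]
        by (intro CollectI exI[of _ "\<lambda>n. f n x"]) auto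
      then obtain y where y: "y \<in> k" "dist y s < \<epsilon> / 3" using k by auto
      have "T x - s = (\<Sum>n. f (n + N) x *\<^sub>C v (n + N))"
        unfolding T_def s_def using suminf_split_initial_segment[OF summable_term, of x N] by simp
      also have "norm \<dots> \<le> (\<Sum>n. norm (f (n + N) x *\<^sub>C v (n + N)))"
        by (rule summable_norm) (use summable_ignore_initial_segment[OF summable_norm_term] in blast)
      also have "\<dots> \<le> (\<Sum>n. norm x * norm (v (n + N)))"
        by (intro suminf_le norm_term summable_mult summable_ignore_initial_segment
            [OF summable_norm_term] summable_ignore_initial_segment[OF summable_v])
      also have "\<dots> = norm x * (\<Sum>n. norm (v (n + N)))"
        by (intro suminf_mult summable_ignore_initial_segment[OF summable_v])
      also have "\<dots> \<le> r * (\<Sum>n. norm (v (n + N)))"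
        by (intro mult_right_mono r that suminf_nonneg summable_ignore_initial_segment
            [OF summable_v]) auto
      also have "\<dots> < r * (\<epsilon> / (3 * r))" by (rule mult_strict_left_mono[OF N r(2)])
      also have "\<dots> = \<epsilon> / 3" using r by simp
      finally have "dist s (T x) < \<epsilon> / 3" by (simp add: dist_norm norm_minus_commute)
      then show ?thesis using y dist_triangle[of y "T x" s] by (intro bexI[of _ y]) auto
    qed
    have "closure (T ` S) \<subseteq> (\<Union>x\<in>k. ball x \<epsilon>)"
    proof
      fix z assume "z \<in> closure (T ` S)"
      then have "\<forall>d>0. \<exists>x\<in>S. dist (T x) z < d" by (simp add: closure_approachable)
      moreover have "\<epsilon> / 3 > 0" using \<open>\<epsilon> > 0\<close> by simp
      ultimately obtain x where x: "x \<in> S" "dist (T x) z < \<epsilon> / 3" by blast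
      obtain y where "y \<in> k" "dist y (T x) < 2 * \<epsilon> / 3" using near[OF x(1)] by blast
      then show "z \<in> (\<Union>x\<in>k. ball x \<epsilon>)"
        using x(2) dist_triangle[of y z "T x"] by (intro UN_I[of y]) auto
    qed
    then show ?thesis using k(1) by blast
  qed
  then show "compact (closure (T ` S))"
    by (simp add: compact_eq_totally_bounded complete_eq_closed)
qed

text \<open>Triangularity makes \<open>T\<^sup>k\<close> vanish on the first \<open>k\<close> vectors \<open>v\<close>, so that only the tail of the
  series for \<open>T x\<close> contributes to \<open>T\<^sup>k (T x)\<close>. The norm bounds for successive powers therefore
  have ratios tending to 0, as the ratio test for the Neumann series requires.\<close>

lemma invertible_operator_if_strictly_triangular:
  assumes triangular: "\<And>j n. n \<le> j \<Longrightarrow> f j (v n) = 0" and "\<mu> \<noteq> 0"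
  shows "invertible_operator (\<lambda>x. T x - \<mu> *\<^sub>C x)"
proof -
  note pow = bounded_clinear_funpow[OF bounded_clinear_T]
  note lin = bounded_clinear_linear[OF pow]
  interpret T: bounded_linear T by (rule bounded_clinear_linear[OF bounded_clinear_T])
  have kill: "(T ^^ Suc k) (v n) = 0" if "n \<le> k" for k n
    using that
  proof (induction k arbitrary: n)
    case 0
    then show ?case using triangular[of 0] by (simp add: T_def)
  next
    case (Suc k)
    have "T (v n) = (\<Sum>j<n. f j (v n) *\<^sub>C v j)"
      unfolding T_def by (rule suminf_finite) (use triangular in auto)
    then have "(T ^^ Suc (Suc k)) (v n) = (T ^^ Suc k) (\<Sum>j<n. f j (v n) *\<^sub>C v j)"
      by (metis funpow_Suc_right o_apply)
    also have "\<dots> = (\<Sum>j<n. f j (v n) *\<^sub>C (T ^^ Suc k) (v j))"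
      by (subst linear_sum[OF bounded_linear.linear[OF lin]])
        (simp only: bounded_clinear_scaleC[OF pow])
    also have "\<dots> = 0"
      using Suc.IH Suc.prems by (intro sum.neutral) (auto simp del: funpow.simps)
    finally show ?case .
  qed
  define q where "q k = (\<Sum>n. norm (v (n + k)))" for k
  obtain C where C: "C > 0" "\<And>x. norm (T x) \<le> norm x * C" using T.pos_bounded by blast
  \<comment> \<open>A bound for the norm of the power of exponent \<open>k\<close>: each factor beyond the first
    contributes a tail.\<close>
  define M where "M k = (case k of 0 \<Rightarrow> 1 | Suc k \<Rightarrow> C * (\<Prod>i<k. q (Suc i)))" for k
  have q0: "q k \<ge> 0" for k
    unfolding q_def by (intro suminf_nonneg summable_ignore_initial_segment[OF summable_v]) auto
  have M0: "M k \<ge> 0" for k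
    using C(1) q0 by (cases k) (auto simp: M_def intro!: mult_nonneg_nonneg prod_nonneg)
  have step: "norm ((T ^^ Suc (Suc k)) x) \<le> (B * q (Suc k)) * norm x"
    if B: "\<And>x. norm ((T ^^ Suc k) x) \<le> B * norm x" and "B \<ge> 0" for k B x
  proof -
    have le: "norm (f n x *\<^sub>C (T ^^ Suc k) (v n)) \<le> (norm x * B) * norm (v n)" for n
      using norm_term[of n x "(T ^^ Suc k) (v n)"] mult_left_mono[OF B[of "v n"], of "norm x"]
      by (simp add: mult.assoc)
    have sum: "summable (\<lambda>n. norm (f n x *\<^sub>C (T ^^ Suc k) (v n)))"
      by (rule summable_comparison_test'[OF summable_mult[OF summable_v, of "norm x * B"], of 0])
        (use le in auto)
    have "(T ^^ Suc (Suc k)) x = (T ^^ Suc k) (\<Sum>n. f n x *\<^sub>C v n)"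
      by (metis funpow_Suc_right o_apply T_def)
    also have "\<dots> = (\<Sum>n. f n x *\<^sub>C (T ^^ Suc k) (v n))"
      by (subst bounded_linear.suminf[OF lin summable_term])
        (simp only: bounded_clinear_scaleC[OF pow])
    also have "\<dots> = (\<Sum>n. f (n + Suc k) x *\<^sub>C (T ^^ Suc k) (v (n + Suc k)))"
      by (subst suminf_split_initial_segment[OF summable_norm_cancel[OF sum], of "Suc k"])
        (auto intro!: sum.neutral simp: less_Suc_eq_le kill simp del: funpow.simps)
    also have "norm \<dots> \<le> (\<Sum>n. norm (f (n + Suc k) x *\<^sub>C (T ^^ Suc k) (v (n + Suc k))))"
      by (rule summable_norm) (use summable_ignore_initial_segment[OF sum] in blast)
    also have "\<dots> \<le> (\<Sum>n. (norm x * B) * norm (v (n + Suc k)))"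
      by (intro suminf_le le summable_mult summable_ignore_initial_segment[OF sum]
            summable_ignore_initial_segment[OF summable_v])
    also have "\<dots> = (norm x * B) * q (Suc k)"
      unfolding q_def by (intro suminf_mult summable_ignore_initial_segment[OF summable_v])
    finally show ?thesis by (simp add: mult_ac)
  qed
  have bound_Suc: "norm ((T ^^ Suc k) x) \<le> M (Suc k) * norm x" for k x
  proof (induction k arbitrary: x)
    case 0
    then show ?case using C(2)[of x] by (simp add: M_def mult.commute)
  next
    case (Suc k)
    have "M (Suc (Suc k)) = M (Suc k) * q (Suc k)" by (simp add: M_def)
    then show ?case using step[OF Suc M0] by (simp only:)
  qed
  have bound: "norm ((T ^^ k) x) \<le> M k * norm x" for k x
    using bound_Suc[of "k - 1" x] by (cases k) (simp_all add: M_def)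
  have "summable (\<lambda>k. M k / cmod \<mu> ^ k)"
  proof -
    have "(\<lambda>k. q k) \<longlonglongrightarrow> 0" using tail_tendsto_0 by (simp add: q_def)
    then have "\<forall>\<^sub>F k in sequentially. q k < cmod \<mu> / 2"
      using order_tendstoD(2)[of q 0 sequentially "cmod \<mu> / 2"] \<open>\<mu> \<noteq> 0\<close> by simp
    then obtain N where N: "\<And>k. k \<ge> N \<Longrightarrow> q k < cmod \<mu> / 2"
      by (auto simp: eventually_sequentially)
    have "summable (\<lambda>k. M (Suc k) / cmod \<mu> ^ Suc k)"
    proof (rule summable_ratio_test[of "1/2" N])
      fix k assume "N \<le> k"
      have "M (Suc (Suc k)) = M (Suc k) * q (Suc k)" by (simp add: M_def)
      then have "M (Suc (Suc k)) \<le> M (Suc k) * (cmod \<mu> / 2)"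
        using mult_left_mono[OF less_imp_le[OF N[of "Suc k"]] M0[of "Suc k"]] \<open>N \<le> k\<close> by simp
      then have "M (Suc (Suc k)) / cmod \<mu> ^ Suc (Suc k)
          \<le> (M (Suc k) * (cmod \<mu> / 2)) / cmod \<mu> ^ Suc (Suc k)"
        by (rule divide_right_mono) simp
      also have "\<dots> = 1/2 * (M (Suc k) / cmod \<mu> ^ Suc k)" using \<open>\<mu> \<noteq> 0\<close> by simp
      finally show "norm (M (Suc (Suc k)) / cmod \<mu> ^ Suc (Suc k))
          \<le> 1/2 * norm (M (Suc k) / cmod \<mu> ^ Suc k)"
        using M0 by simp
    qed simp
    then show ?thesis by (subst (asm) summable_Suc_iff)
  qed
  with bound show ?thesis
    by (intro invertible_operator_if_powers_summable[OF bounded_clinear_T \<open>\<mu> \<noteq> 0\<close>])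
qed

end

section \<open>Orthonormal bases\<close>

lemma cinner_zero_left [simp]: "cinner 0 y = 0"
  using cinner_scaleC_left[of 0 0 y] by simp

lemma cinner_scaleR_left: "cinner (r *\<^sub>R x) y = complex_of_real r * cinner x y"
  using cinner_scaleC_left[of "of_real r" x y] by (simp add: scaleC_of_real)

lemma cinner_diff_left: "cinner (x - y) z = cinner x z - cinner y z"
  using cinner_add_left[of "x - y" y z] by simp

lemma cinner_sum_left: "cinner (\<Sum>a\<in>A. g a) y = (\<Sum>a\<in>A. cinner (g a) y)"
  by (induction A rule: infinite_finite_induct) (auto simp: cinner_add_left)

text \<open>Pythagoras for \<open>x\<close>, its projection to the line of \<open>u\<close>, and the remainder \<open>y\<close>.\<close>

lemma cmod_cinner_unit_le:
  assumes "norm u = 1"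
  shows "cmod (cinner x u) \<le> norm x"
proof -
  define c where "c = cinner x u"
  define y where "y = x - c *\<^sub>C u"
  have "cinner y u = 0"
    by (simp add: y_def cinner_diff_left cinner_scaleC_left cinner_same assms c_def)
  then have "cinner u y = 0" using cinner_commute[of u y] by simp
  then have "cinner y y = cinner x y" by (simp add: y_def cinner_diff_left cinner_scaleC_left)
  also have "\<dots> = cnj (cinner x x - c * cinner u x)"
    using cinner_commute[of x y] by (simp add: y_def cinner_diff_left cinner_scaleC_left)
  also have "cinner u x = cnj c" unfolding c_def by (rule cinner_commute)
  finally have "complex_of_real ((norm y)\<^sup>2) = complex_of_real ((norm x)\<^sup>2 - (cmod c)\<^sup>2)"
    by (simp add: cinner_same mult.commute flip: complex_norm_square)
  then have "(norm y)\<^sup>2 = (norm x)\<^sup>2 - (cmod c)\<^sup>2" by (simp only: of_real_eq_iff)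
  then have "(cmod c)\<^sup>2 \<le> (norm x)\<^sup>2" using zero_le_power2[of "norm y"] by linarith
  then show ?thesis unfolding c_def by (rule power2_le_imp_le) simp
qed

lemma bounded_linear_cinner_unit:
  assumes "norm u = 1"
  shows "bounded_linear (\<lambda>x. cinner x u)"
  by (rule bounded_linear_intro[where K = 1])
    (use cmod_cinner_unit_le[OF assms] in \<open>auto simp: cinner_add_left cinner_scaleR_left scaleR_conv_of_real\<close>)

locale orthonormal_basis =
  fixes e :: "nat \<Rightarrow> 'a::chilbert_space"
  assumes cinner_e: "cinner (e i) (e j) = of_bool (i = j)"
    and dense: "closure (cspan (range e)) = UNIV"
begin

lemma norm_e: "norm (e i) = 1"
proof -
  have "complex_of_real ((norm (e i))\<^sup>2) = 1" using cinner_e[of i i] by (simp add: cinner_same)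
  then have "(norm (e i))\<^sup>2 = 1" by (simp only: of_real_eq_1_iff)
  then show ?thesis by (simp add: power2_eq_1_iff) (metis norm_ge_zero not_one_le_zero neg_0_le_iff_le)
qed

lemma in_closed_subspace_if_basis_in:
  assumes "closed W" "complex_vector.subspace W" "\<And>n. e n \<in> W"
  shows "x \<in> W"
proof -
  have "cspan (range e) \<subseteq> W" using assms by (intro complex_vector.span_minimal) auto
  then have "closure (cspan (range e)) \<subseteq> W" using assms(1) by (rule closure_minimal)
  then show ?thesis using dense by auto
qed

lemma eq_0_if_coordinates_eq_0:
  assumes "\<And>n. cinner y (e n) = 0"
  shows "y = 0"
proof (rule ccontr)
  assume "y \<noteq> 0"
  define u where "u = (1 / norm y) *\<^sub>R y"
  have u: "norm u = 1" using \<open>y \<noteq> 0\<close> by (simp add: u_def)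
  have "u \<in> {x. cinner x u = 0}"
  proof (rule in_closed_subspace_if_basis_in)
    show "closed {x. cinner x u = 0}"
      by (intro closed_Collect_eq linear_continuous_on[OF bounded_linear_cinner_unit[OF u]] continuous_on_const)
    show "complex_vector.subspace {x. cinner x u = 0}"
      by (intro complex_vector.subspaceI) (auto simp: cinner_add_left cinner_scaleC_left)
    show "e n \<in> {x. cinner x u = 0}" for n
      using cinner_commute[of "e n" u] assms[of n] by (simp add: u_def cinner_scaleR_left)
  qed
  then show False using u by (simp add: cinner_same)
qed

lemma operator_eq_0_if_eq_0_on_basis:
  assumes "bounded_clinear X" "\<And>n. X (e n) = 0"
  shows "X x = 0"
proof -
  interpret X: bounded_linear X by (rule bounded_clinear_linear[OF assms(1)])
  have "x \<in> {x. X x = 0}"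
  proof (rule in_closed_subspace_if_basis_in)
    show "closed {x. X x = 0}"
      by (intro closed_Collect_eq linear_continuous_on[OF X.bounded_linear_axioms] continuous_on_const)
    show "complex_vector.subspace {x. X x = 0}"
      by (intro complex_vector.subspaceI) (auto simp: X.add X.zero bounded_clinear_scaleC[OF assms(1)])
  qed (use assms(2) in auto)
  then show ?thesis by simp
qed

end

text \<open>A Gram--Schmidt step which also extends the system when \<open>s\<close> is already in its span, so
  that the resulting sequence is infinite.\<close>

lemma orthonormal_extend:
  fixes e :: "nat \<Rightarrow> 'a::complex_inner"
  assumes inf: "\<not> finite_cdim (UNIV :: 'a set)"
    and on: "\<And>i j. i < n \<Longrightarrow> j < n \<Longrightarrow> cinner (e i) (e j) = of_bool (i = j)"
  shows "\<exists>u. norm u = 1 \<and> (\<forall>j<n. cinner u (e j) = 0) \<and> s \<in> cspan (insert u (e ` {..<n}))"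
proof -
  let ?B = "e ` {..<n}"
  obtain v where v: "v \<notin> cspan ?B" "s \<in> cspan (insert v ?B)"
  proof (cases "s \<in> cspan ?B")
    case True
    have "cspan ?B \<noteq> UNIV" using inf unfolding finite_cdim_def by blast
    then obtain v where "v \<notin> cspan ?B" by auto
    moreover have "s \<in> cspan (insert v ?B)"
      using True complex_vector.span_mono[of ?B "insert v ?B"] by blast
    ultimately show ?thesis by (rule that)
  next
    case False
    then show ?thesis using that[of s] complex_vector.span_base by blast
  qed
  define p where "p = (\<Sum>j<n. cinner v (e j) *\<^sub>C e j)"
  have p: "p \<in> cspan ?B"
    unfolding p_def
    by (intro complex_vector.span_sum complex_vector.span_scale complex_vector.span_base) auto
  define u where "u = (1 / norm (v - p)) *\<^sub>R (v - p)"
  have nz: "v - p \<noteq> 0" using p v by auto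
  have "cinner u (e i) = 0" if "i < n" for i
  proof -
    have "cinner p (e i) = (\<Sum>j<n. if j = i then cinner v (e j) else 0)"
      unfolding p_def cinner_sum_left
      by (intro sum.cong refl) (use on that in \<open>auto simp: cinner_scaleC_left\<close>)
    then show ?thesis using that by (simp add: u_def cinner_scaleR_left cinner_diff_left)
  qed
  moreover have "norm u = 1" using nz by (simp add: u_def)
  moreover have "v = p + complex_of_real (norm (v - p)) *\<^sub>C u"
    using nz by (simp add: u_def scaleC_of_real)
  then have "v \<in> cspan (insert u ?B)"
    using p complex_vector.span_mono[of ?B "insert u ?B"]
    by (metis complex_vector.span_add complex_vector.span_base complex_vector.span_scale insertI1
        subset_eq subset_insertI)
  then have "cspan (insert v ?B) \<subseteq> cspan (insert u ?B)"
    by (intro complex_vector.span_minimal complex_vector.subspace_span)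
      (auto intro: complex_vector.span_base)
  ultimately show ?thesis using v by blast
qed

text \<open>Each member of a dense sequence is absorbed into the span at its own step, so the span of the
  whole system contains a dense set.\<close>

lemma exists_orthonormal_basis:
  assumes "separable_space (euclidean :: 'a::chilbert_space topology)"
    and inf: "\<not> finite_cdim (UNIV :: 'a set)"
  shows "\<exists>e :: nat \<Rightarrow> 'a. orthonormal_basis e"
proof -
  obtain D :: "'a set" where D: "countable D" "closure D = UNIV"
    using assms(1) by (auto simp: separable_space_def)
  define s where "s = from_nat_into D"
  have "D \<noteq> {}" using D(2) by auto
  then have s: "range s = D" using D(1) by (simp add: s_def)
  let ?P = "\<lambda>e n u. norm u = 1 \<and> (\<forall>j<n. cinner u (e j) = 0) \<and> s n \<in> cspan (insert u (e ` {..<n}))"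
  have on: "cinner (e i) (e j) = of_bool (i = j)"
    if "?P e i (e i)" "?P e j (e j)" for e :: "nat \<Rightarrow> 'a" and i j
    using that cinner_commute[of "e i" "e j"]
    by (cases i j rule: linorder_cases) (auto simp: cinner_same)
  have "\<exists>e. \<forall>n. ?P e n (e n)"
  proof (rule dependent_wellorder_choice)
    fix r and f g :: "nat \<Rightarrow> 'a" and n
    assume "\<And>y. y < n \<Longrightarrow> f y = g y"
    then have "f ` {..<n} = g ` {..<n}" "\<forall>j<n. f j = g j" by auto
    then show "?P f n r = ?P g n r" by simp
  next
    fix n and e :: "nat \<Rightarrow> 'a"
    assume "\<And>y. y < n \<Longrightarrow> ?P e y (e y)"
    then show "\<exists>u. ?P e n u" using on by (intro orthonormal_extend[OF inf]) blast
  qed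
  then obtain e where e: "\<And>n. ?P e n (e n)" by blast
  have "s n \<in> cspan (range e)" for n
  proof -
    have "cspan (insert (e n) (e ` {..<n})) \<subseteq> cspan (range e)"
      by (intro complex_vector.span_mono) auto
    then show ?thesis using e by blast
  qed
  then have "D \<subseteq> cspan (range e)" using s by auto
  then have "closure (cspan (range e)) = UNIV" using D(2) closure_mono by blast
  then have "orthonormal_basis e" using on[OF e e] by unfold_locales auto
  then show ?thesis by blast
qed

section \<open>A weighted shift with rare jumps\<close>

text \<open>The gaps between the jumps tend to infinity, so around a late jump there is room for the windows
  of any fixed length \<open>m\<close> that are considered below.\<close>

definition jump :: "nat \<Rightarrow> bool" where
  "jump n \<longleftrightarrow> (\<exists>j. n = 4 ^ Suc j)"

text \<open>The two shift weights next to a jump are negligible against the jump weight and against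
  products of boundedly many ordinary weights. The value 0 at \<open>n = 0\<close> makes the shift kill \<open>e 0\<close>, in spite
  of \<open>0 - 1 = 0\<close> in the natural numbers.\<close>

definition shift_weight :: "nat \<Rightarrow> real" where
  "shift_weight n =
    (if n = 0 then 0 else if jump n \<or> jump (Suc n) then (1/2) ^ n\<^sup>2 else (1/2) ^ n)"

definition jump_weight :: "nat \<Rightarrow> real" where
  "jump_weight n = (if jump n then (1/2) ^ n else 0)"

lemma jump_ge_4: "jump n \<Longrightarrow> n \<ge> 4"
  by (auto simp: jump_def)

lemma exists_large_jump: "\<exists>n\<ge>N. jump n"
proof -
  have "N < 2 ^ N" by (rule less_exp)
  also have "\<dots> \<le> 4 ^ N" by (rule power_mono) auto
  also have "\<dots> \<le> 4 ^ Suc N" by simp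
  finally have "N \<le> 4 ^ Suc N" by (rule less_imp_le)
  then show ?thesis unfolding jump_def by blast
qed

lemma not_jump_near_jump:
  assumes "jump n" "4 * (m + 2) \<le> n" "n \<le> j + m + 1" "j \<le> n + m + 1" "j \<noteq> n"
  shows "\<not> jump j"
proof
  assume "jump j"
  with \<open>jump n\<close> obtain a b where ab: "n = 4 ^ Suc a" "j = 4 ^ Suc b" by (auto simp: jump_def)
  have far: "4 * 4 ^ Suc c \<le> (4::nat) ^ Suc d" if "c < d" for c d
    using power_increasing[of "Suc (Suc c)" "Suc d" "4::nat"] that by simp
  consider "a < b" | "b < a" using ab \<open>j \<noteq> n\<close> by (cases a b rule: linorder_cases) auto
  then have "4 * n \<le> j \<or> 4 * j \<le> n" using far ab by (metis)
  then show False using assms(2-4) by auto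
qed

lemma not_jump_Suc_jump: "jump n \<Longrightarrow> \<not> jump (Suc n)"
proof -
  assume "jump n"
  then have "even n" by (auto simp: jump_def)
  then show ?thesis by (auto simp: jump_def elim!: evenE) presburger
qed

lemma shift_weight_0 [simp]: "shift_weight 0 = 0"
  by (simp add: shift_weight_def)

lemma shift_weight_pos: "n > 0 \<Longrightarrow> shift_weight n > 0"
  by (simp add: shift_weight_def)

lemma shift_weight_nonneg: "shift_weight n \<ge> 0"
  by (simp add: shift_weight_def)

lemma shift_weight_le: "shift_weight n \<le> (1/2) ^ n"
  by (auto simp: shift_weight_def power2_eq_square intro!: power_decreasing)

lemma jump_weight_eq_0: "\<not> jump n \<Longrightarrow> jump_weight n = 0"
  by (simp add: jump_weight_def)

lemma jump_weight_small [simp]: "n < 4 \<Longrightarrow> jump_weight n = 0"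
  using jump_ge_4[of n] by (intro jump_weight_eq_0) auto

text \<open>The factor by which \<open>m\<close> steps of the shift carry index \<open>r + m\<close> to index \<open>r\<close>.\<close>

definition weight_prod :: "nat \<Rightarrow> nat \<Rightarrow> real" where
  "weight_prod m r = (\<Prod>s<m. shift_weight (Suc (r + s)))"

lemma weight_prod_pos: "weight_prod m r > 0"
  unfolding weight_prod_def by (intro prod_pos) (auto intro: shift_weight_pos)

lemma weight_prod_le_1: "weight_prod m r \<le> 1"
  unfolding weight_prod_def
proof (intro prod_le_1 conjI shift_weight_nonneg)
  show "shift_weight (Suc (r + s)) \<le> 1" for s
    using shift_weight_le[of "Suc (r + s)"] power_le_one[of "1/2::real" "Suc (r + s)"] by linarith
qed

lemma weight_prod_slide:
  "weight_prod m (Suc r) * shift_weight (Suc r) = weight_prod m r * shift_weight (Suc (r + m))"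
proof -
  have "weight_prod m (Suc r) * shift_weight (Suc r) = weight_prod (Suc m) r"
    unfolding weight_prod_def by (subst prod.lessThan_Suc_shift) (simp add: mult.commute)
  then show ?thesis by (simp add: weight_prod_def)
qed

lemma weight_prod_ge:
  assumes "\<And>j. r < j \<Longrightarrow> j \<le> r + m + 1 \<Longrightarrow> \<not> jump j" "r + m \<le> N"
  shows "weight_prod m r \<ge> (1/2) ^ (N * m)"
proof -
  have "(\<Prod>s<m. (1/2) ^ N) \<le> weight_prod m r"
    unfolding weight_prod_def
  proof (intro prod_mono conjI)
    fix s assume "s \<in> {..<m}"
    then have "shift_weight (Suc (r + s)) = (1/2) ^ Suc (r + s)"
      using assms(1)[of "Suc (r + s)"] assms(1)[of "Suc (Suc (r + s))"]
      by (simp add: shift_weight_def)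
    also have "\<dots> \<ge> (1/2) ^ N"
      using \<open>s \<in> {..<m}\<close> assms(2) by (intro power_decreasing) auto
    finally show "(1/2) ^ N \<le> shift_weight (Suc (r + s))" .
  qed simp
  then show ?thesis by (simp add: power_mult)
qed

lemma power_mult_half_power_square_tendsto_0:
  fixes B :: real
  assumes "B > 0"
  shows "(\<lambda>n. B ^ n * (1/2) ^ (n - 1)\<^sup>2) \<longlonglongrightarrow> 0"
proof -
  obtain k where k: "2 * B < 2 ^ k" using real_arch_pow[of 2 "2 * B"] by auto
  show ?thesis
  proof (rule tendsto_sandwich[where f = "\<lambda>_. 0" and h = "\<lambda>n. (1/2) ^ n"])
    show "\<forall>\<^sub>F n in sequentially. B ^ n * (1/2) ^ (n - 1)\<^sup>2 \<le> (1/2::real) ^ n"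
    proof (rule eventually_sequentiallyI[of "k + 2"])
      fix n assume "k + 2 \<le> n"
      then obtain d where d: "n = k + 2 + d" using le_Suc_ex by blast
      have "k * n \<le> (n - 1)\<^sup>2" by (simp add: d power2_eq_square algebra_simps)
      then have "(1/2) ^ (n - 1)\<^sup>2 \<le> (1/2::real) ^ (k * n)" by (intro power_decreasing) auto
      then have "B ^ n * (1/2) ^ (n - 1)\<^sup>2 \<le> B ^ n * (1/2) ^ (k * n)"
        using assms by (intro mult_left_mono) auto
      also have "\<dots> = (B * (1/2) ^ k) ^ n" by (simp add: power_mult power_mult_distrib)
      also have "\<dots> \<le> (1/2) ^ n"
        using k assms by (intro power_mono) (auto simp: field_simps power_one_over)
      finally show "B ^ n * (1/2) ^ (n - 1)\<^sup>2 \<le> (1/2) ^ n" .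
    qed
    show "(\<lambda>n. (1/2::real) ^ n) \<longlonglongrightarrow> 0" by (rule LIMSEQ_power_zero) simp
    show "\<forall>\<^sub>F n in sequentially. 0 \<le> B ^ n * (1/2) ^ (n - 1)\<^sup>2"
      using assms by (intro always_eventually) auto
  qed simp
qed

context orthonormal_basis
begin

definition coord :: "nat \<Rightarrow> 'a \<Rightarrow> complex" where
  "coord i x = cinner x (e i)"

definition shifted :: "nat \<Rightarrow> 'a" where
  "shifted n = shift_weight n *\<^sub>R e (n - 1) + jump_weight n *\<^sub>R e (n - 2)"

lemma norm_shifted: "norm (shifted n) \<le> 2 * (1/2) ^ n"
proof -
  have "norm (shifted n) \<le> norm (shift_weight n *\<^sub>R e (n - 1)) + norm (jump_weight n *\<^sub>R e (n - 2))"
    unfolding shifted_def by (rule norm_triangle_ineq)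
  also have "\<dots> = shift_weight n + jump_weight n"
    by (simp add: norm_e shift_weight_nonneg jump_weight_def)
  also have "\<dots> \<le> (1/2) ^ n + (1/2) ^ n"
    by (intro add_mono shift_weight_le) (simp add: jump_weight_def)
  finally show ?thesis by simp
qed

sublocale nuclear coord shifted
proof
  show "coord n (x + y) = coord n x + coord n y" "coord n (a *\<^sub>C x) = a * coord n x"
    "cmod (coord n x) \<le> norm x" for n x y a
    by (simp_all add: coord_def cinner_add_left cinner_scaleC_left cmod_cinner_unit_le norm_e)
  have "summable (\<lambda>n. 2 * (1/2) ^ n :: real)" by (intro summable_mult summable_geometric) simp
  then show "summable (\<lambda>n. norm (shifted n))"
    by (rule summable_comparison_test'[of _ 0]) (use norm_shifted in auto)
qed

lemma coord_e: "coord i (e j) = of_bool (i = j)"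
  by (auto simp: coord_def cinner_e)

lemma coord_scaleR: "coord i (r *\<^sub>R x) = complex_of_real r * coord i x"
  by (simp add: coord_def cinner_scaleR_left)

lemma coord_shifted:
  "coord i (shifted n) = shift_weight n * of_bool (n = i + 1) + jump_weight n * of_bool (n = i + 2)"
proof -
  have "coord i (shifted n) =
      complex_of_real (shift_weight n * of_bool (i = n - 1) + jump_weight n * of_bool (i = n - 2))"
    by (simp add: shifted_def f_add coord_scaleR coord_e)
  also have "shift_weight n * of_bool (i = n - 1) = shift_weight n * of_bool (n = i + 1)"
    by (cases n) auto
  also have "jump_weight n * of_bool (i = n - 2) = jump_weight n * of_bool (n = i + 2)"
  proof (cases "n < 4")
    case False
    then have "i = n - 2 \<longleftrightarrow> n = i + 2" by arith
    then show ?thesis by simp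
  qed simp
  finally show ?thesis by simp
qed

lemma T_e: "T (e j) = shifted j"
proof -
  have "T (e j) = (\<Sum>n\<in>{j}. coord n (e j) *\<^sub>C shifted n)"
    unfolding T_def by (intro suminf_finite) (auto simp: coord_e)
  then show ?thesis by (simp add: coord_e)
qed

lemma coord_T:
  "coord i (T x) = shift_weight (i + 1) * coord (i + 1) x + jump_weight (i + 2) * coord (i + 2) x"
proof -
  have "bounded_linear (coord i)"
    using bounded_linear_cinner_unit[OF norm_e] unfolding coord_def .
  then have "coord i (T x) = (\<Sum>n. coord n x * coord i (shifted n))"
    unfolding T_def by (simp add: bounded_linear.suminf[OF _ summable_term] f_scaleC)
  also have "\<dots> = (\<Sum>n\<in>{i + 1, i + 2}. coord n x * coord i (shifted n))"
    by (intro suminf_finite) (auto simp: coord_shifted)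
  finally show ?thesis by (simp add: coord_shifted mult.commute)
qed

lemma T_e_0: "T (e 0) = 0"
  by (simp add: T_e shifted_def)

lemma quasinilpotent_T: "quasinilpotent T"
proof -
  have "invertible_operator (\<lambda>x. T x - \<mu> *\<^sub>C x)" if "\<mu> \<noteq> 0" for \<mu>
  proof (rule invertible_operator_if_strictly_triangular[OF _ that])
    show "coord j (shifted n) = 0" if "n \<le> j" for j n
      using that by (simp add: coord_shifted)
  qed
  moreover have "\<not> invertible_operator (\<lambda>x. T x - 0 *\<^sub>C x)"
  proof
    assume "invertible_operator (\<lambda>x. T x - 0 *\<^sub>C x)"
    then obtain S where S: "bounded_clinear S" "S \<circ> T = id"
      by (auto simp: invertible_operator_def)
    have "e 0 = S (T (e 0))" using fun_cong[OF S(2), of "e 0"] by simp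
    also have "\<dots> = 0" using bounded_clinear_scaleC[OF S(1), of 0 0] by (simp add: T_e_0)
    finally show False using norm_e[of 0] by simp
  qed
  ultimately show ?thesis by (auto simp: quasinilpotent_def spectrum_def)
qed

lemma T_pow_e:
  assumes "\<And>j. n < j \<Longrightarrow> j \<le> n + m \<Longrightarrow> \<not> jump j"
  shows "(T ^^ m) (e (n + m)) = weight_prod m n *\<^sub>R e n"
  using assms
proof (induction m)
  case (Suc m)
  interpret p: bounded_linear "T ^^ m"
    by (rule bounded_clinear_linear[OF bounded_clinear_funpow[OF bounded_clinear_T]])
  have "(T ^^ Suc m) (e (n + Suc m)) = (T ^^ m) (T (e (n + Suc m)))"
    by (metis funpow_Suc_right o_apply)
  also have "\<dots> = shift_weight (Suc (n + m)) *\<^sub>R (T ^^ m) (e (n + m))"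
    using Suc.prems[of "n + Suc m"] by (simp add: T_e shifted_def jump_weight_eq_0 p.scaleR)
  also have "\<dots> = weight_prod (Suc m) n *\<^sub>R e n"
    using Suc by (simp add: weight_prod_def mult.commute)
  finally show ?case .
qed (simp add: weight_prod_def)

lemma coord_T_pow:
  assumes "\<And>j. r + 2 \<le> j \<Longrightarrow> j \<le> r + m + 1 \<Longrightarrow> \<not> jump j"
  shows "coord r ((T ^^ m) y) = weight_prod m r * coord (r + m) y"
  using assms
proof (induction m arbitrary: y)
  case (Suc m)
  have "coord r ((T ^^ Suc m) y) = coord r ((T ^^ m) (T y))"
    by (metis funpow_Suc_right o_apply)
  also have "\<dots> = weight_prod m r * coord (r + m) (T y)" using Suc by simp
  also have "\<dots> = weight_prod (Suc m) r * coord (r + Suc m) y"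
    using Suc.prems[of "r + m + 2"] by (simp add: coord_T jump_weight_eq_0 weight_prod_def)
  finally show ?case .
qed (simp add: weight_prod_def)

text \<open>The equation for coordinate \<open>j\<close> of \<open>T x\<close> involves two coordinates of \<open>x\<close> only if \<open>j + 2\<close> is a
  jump; then \<open>j + 3\<close> is not, and the next equation already eliminates the second one.\<close>

lemma coord_eq_0_if_coord_T_eq_0:
  assumes "\<And>i. i \<ge> s \<Longrightarrow> coord i (T x) = 0" "i > s"
  shows "coord i x = 0"
proof -
  obtain j where j: "i = j + 1" "j \<ge> s" using assms(2) by (cases i) auto
  have *: "shift_weight (k + 1) * coord (k + 1) x + jump_weight (k + 2) * coord (k + 2) x = 0"
    if "k \<ge> s" for k
    using assms(1)[OF that] by (simp add: coord_T)
  have z: "jump_weight (j + 2) * coord (j + 2) x = 0"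
  proof (cases "jump (j + 2)")
    case True
    then have "jump_weight (j + 3) = 0"
      using not_jump_Suc_jump[of "j + 2"] by (intro jump_weight_eq_0) (simp add: numeral_eq_Suc)
    then show ?thesis
      using *[of "j + 1"] j shift_weight_pos[of "j + 2"] by (simp add: numeral_eq_Suc)
  qed (simp add: jump_weight_eq_0)
  show ?thesis using *[OF j(2)] j(1) shift_weight_pos[of "j + 1"] unfolding z by simp
qed

end

section \<open>Intertwiners\<close>

locale intertwiner = orthonormal_basis +
  fixes X :: "'a \<Rightarrow> 'a" and \<mu> :: complex
  assumes X: "bounded_clinear X"
    and intertwines: "X (T x) = \<mu> *\<^sub>C T (X x)"
begin

sublocale X: bounded_linear X
  by (rule bounded_clinear_linear[OF X])

lemma X_T_pow: "X ((T ^^ k) x) = \<mu> ^ k *\<^sub>C (T ^^ k) (X x)"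
proof (induction k)
  case (Suc k)
  then show ?case
    by (simp add: intertwines bounded_clinear_scaleC[OF bounded_clinear_T] scaleC_scaleC)
qed (use complex_vector.scale_one in simp)

definition entry :: "nat \<Rightarrow> nat \<Rightarrow> complex" where
  "entry i j = coord i (X (e j))"

lemma coord_X_shifted:
  "coord i (X (shifted j)) = shift_weight j * entry i (j - 1) + jump_weight j * entry i (j - 2)"
  by (simp add: shifted_def X.add X.scaleR f_add coord_scaleR entry_def)

lemma entry_relation:
  "shift_weight j * entry i (j - 1) + jump_weight j * entry i (j - 2) =
    \<mu> * (shift_weight (i + 1) * entry (i + 1) j + jump_weight (i + 2) * entry (i + 2) j)"
proof -
  have "coord i (X (T (e j))) = \<mu> * coord i (T (X (e j)))"
    by (simp add: intertwines f_scaleC)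
  then show ?thesis by (simp add: T_e coord_X_shifted coord_T entry_def)
qed

text \<open>The vectors \<open>T (e 1), T (e 2), \<dots>\<close> span the same space as the basis, so \<open>X T = 0\<close> forces
  \<open>X = 0\<close>.\<close>

lemma eq_0_if_multiplier_0:
  assumes "\<mu> = 0"
  shows "X x = 0"
proof (rule operator_eq_0_if_eq_0_on_basis[OF X])
  fix j show "X (e j) = 0"
  proof (induction j rule: less_induct)
    case (less j)
    have z: "jump_weight (j + 1) *\<^sub>R X (e (j - 1)) = 0"
      using less[of "j - 1"] by (cases "j = 0") auto
    have "X (shifted (j + 1)) = 0"
      using intertwines[of "e (j + 1)"] assms by (simp add: T_e)
    then have "shift_weight (j + 1) *\<^sub>R X (e j) + jump_weight (j + 1) *\<^sub>R X (e (j - 1)) = 0"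
      by (simp add: shifted_def X.add X.scaleR)
    then have "shift_weight (j + 1) *\<^sub>R X (e j) = 0" unfolding z by simp
    then show ?case using shift_weight_pos[of "j + 1"] by simp
  qed
qed

context
  fixes m :: nat
  assumes nonzero: "\<mu> \<noteq> 0"
    and vanish: "\<And>j. j < m \<Longrightarrow> X (e j) = 0"
begin

text \<open>The kernels of the powers of \<open>T\<close> are spanned by initial segments of the basis, and \<open>X\<close>
  respects them; since \<open>X\<close> kills the first \<open>m\<close> basis vectors, it lowers indices by at least
  \<open>m\<close>.\<close>

lemma entry_eq_0: "i > r \<Longrightarrow> entry i (m + r) = 0"
proof (induction r arbitrary: i rule: less_induct)
  case (less r)
  have "coord i (T (X (e (m + r)))) = 0" if "i \<ge> r" for i
  proof -
    have "entry i (m + r - 1) = 0 \<or> m + r = 0"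
      using less.IH[of "r - 1" i] vanish[of "m - 1"] that
      by (cases r; cases m) (auto simp: entry_def f_scaleC[of i 0 0, simplified])
    moreover have "jump_weight (m + r) * entry i (m + r - 2) = 0"
    proof (cases "r \<ge> 2")
      case True
      then have "entry i (m + (r - 2)) = 0" using that by (intro less.IH) auto
      then show ?thesis using True by simp
    next
      case False
      then have "m + r - 2 < m \<or> m + r < 4" by auto
      then show ?thesis using vanish by (auto simp: entry_def f_scaleC[of i 0 0, simplified])
    qed
    ultimately have "coord i (X (shifted (m + r))) = 0" by (auto simp: coord_X_shifted)
    then show ?thesis using intertwines[of "e (m + r)"] nonzero by (simp add: T_e f_scaleC)
  qed
  then show ?case unfolding entry_def using less.prems by (rule coord_eq_0_if_coord_T_eq_0)
qed

text \<open>On the first nonzero diagonal the jump terms drop out of the recursion for the entries, which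
  is therefore that of a plain weighted shift.\<close>

lemma entry_diagonal:
  "weight_prod m 0 * (\<mu> ^ r * entry r (m + r)) = entry 0 m * weight_prod m r"
proof (induction r)
  case (Suc r)
  have z: "jump_weight (m + Suc r) * entry r (m + Suc r - 2) = 0"
  proof (cases "r = 0")
    case True
    then show ?thesis
      using vanish[of "m - 1"] by (cases "m = 0") (auto simp: entry_def f_scaleC[of 0 0 0, simplified])
  next
    case False
    then have "entry r (m + (r - 1)) = 0" by (intro entry_eq_0) auto
    then show ?thesis using False by (simp add: Suc_diff_Suc)
  qed
  have "entry (r + 2) (m + Suc r) = 0" by (intro entry_eq_0) auto
  then have step: "shift_weight (Suc (r + m)) * entry r (m + r)
      = \<mu> * (shift_weight (Suc r) * entry (Suc r) (m + Suc r))"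
    using entry_relation[of "m + Suc r" r] unfolding z by (simp add: add.commute)
  have "complex_of_real (shift_weight (Suc r)) *
        (weight_prod m 0 * (\<mu> ^ Suc r * entry (Suc r) (m + Suc r)))
      = weight_prod m 0 * \<mu> ^ r * (\<mu> * (shift_weight (Suc r) * entry (Suc r) (m + Suc r)))"
    by (simp add: mult_ac)
  also have "\<dots> = shift_weight (Suc (r + m)) * (weight_prod m 0 * (\<mu> ^ r * entry r (m + r)))"
    unfolding step[symmetric] by (simp add: mult_ac)
  also have "\<dots> = entry 0 m * complex_of_real (weight_prod m r * shift_weight (Suc (r + m)))"
    unfolding Suc by simp
  also have "\<dots> = complex_of_real (shift_weight (Suc r)) * (entry 0 m * weight_prod m (Suc r))"
    unfolding weight_prod_slide[symmetric] by simp
  finally show ?case using shift_weight_pos[of "Suc r"] by simp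
qed simp

text \<open>This compares coordinate \<open>r\<close> of \<open>X T\<^sup>m\<^sup>+\<^sup>1 e\<^bsub>n+m\<^esub>\<close> and \<open>\<mu>\<^sup>m\<^sup>+\<^sup>1 T\<^sup>m\<^sup>+\<^sup>1 X e\<^bsub>n+m\<^esub>\<close>. On the
  left the basis vector is shifted down to \<open>e n\<close> and then jumps; on the right a coordinate of
  \<open>X e\<^bsub>n+m\<^esub>\<close> jumps first and is then shifted down to \<open>r\<close>. Both jump terms contain entries of the
  first nonzero diagonal, in rows \<open>r\<close> and \<open>n = r + m + 2\<close>, and these contribute different powers
  of \<open>\<mu>\<close>. The \<open>m\<close> additional applications of
  \<open>T\<close> are there because a comparison at \<open>e n\<close> itself would involve the ordinary weight \<open>r + 1\<close>;
  now the remaining entries carry the negligible weights \<open>n - 1\<close> and \<open>n\<close>.\<close>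

lemma jump_relation:
  assumes n: "jump n" "4 * (m + 2) \<le> n" and r: "n = r + m + 2"
  shows "weight_prod m n * weight_prod m r * jump_weight n * entry 0 m * \<mu> ^ (m + 1) * (\<mu> - 1) =
    weight_prod m 0 * \<mu> ^ n * (\<mu> ^ (m + 1) * weight_prod m r * shift_weight (n - 1) * entry (n - 1) (n + m)
      - weight_prod m n * shift_weight n * entry r (n - 1))"
proof -
  define W where "W k = complex_of_real (weight_prod m k)" for k
  define a where "a = complex_of_real (jump_weight n)"
  define s where "s = complex_of_real (shift_weight n)"
  define s' where "s' = complex_of_real (shift_weight (n - 1))"
  have near: "\<not> jump j" if "n \<le> j + m + 1" "j \<le> n + m + 1" "j \<noteq> n" for j
    by (rule not_jump_near_jump[OF n that])
  have "(T ^^ (m + 1)) (e (n + m)) = T ((T ^^ m) (e (n + m)))" by simp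
  also have "(T ^^ m) (e (n + m)) = weight_prod m n *\<^sub>R e n"
    by (rule T_pow_e) (use near in auto)
  also have "T \<dots> = weight_prod m n *\<^sub>R shifted n"
    using bounded_clinear_scaleC[OF bounded_clinear_T, of "of_real (weight_prod m n)"]
    by (simp add: scaleC_of_real T_e)
  finally have "coord r (X ((T ^^ (m + 1)) (e (n + m)))) = W n * (s * entry r (n - 1) + a * entry r (n - 2))"
    by (simp add: X.scaleR coord_scaleR coord_X_shifted W_def a_def s_def)
  moreover have "coord r (X ((T ^^ (m + 1)) (e (n + m)))) = \<mu> ^ (m + 1) * coord r ((T ^^ m) (T (X (e (n + m)))))"
    unfolding X_T_pow f_scaleC by (metis funpow_Suc_right o_apply Suc_eq_plus1)
  moreover have "coord r ((T ^^ m) (T (X (e (n + m))))) = W r * (s' * entry (n - 1) (n + m) + a * entry n (n + m))"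
    by (subst coord_T_pow) (use near r in \<open>auto simp: coord_T entry_def W_def a_def s'_def\<close>)
  ultimately have key: "W n * (s * entry r (n - 1) + a * entry r (n - 2)) =
      \<mu> ^ (m + 1) * (W r * (s' * entry (n - 1) (n + m) + a * entry n (n + m)))"
    by simp
  have key': "\<mu> ^ (m + 1) * W r * s' * entry (n - 1) (n + m) - W n * s * entry r (n - 1)
      = W n * a * entry r (n - 2) - \<mu> ^ (m + 1) * W r * a * entry n (n + m)"
    using key by (simp add: algebra_simps)
  have d1: "W 0 * \<mu> ^ r * entry r (n - 2) = entry 0 m * W r"
    using entry_diagonal[of r] by (simp add: W_def r add.commute mult.assoc)
  have d2: "W 0 * \<mu> ^ n * entry n (n + m) = entry 0 m * W n"
    using entry_diagonal[of n] by (simp add: W_def add.commute mult.assoc)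
  have "W 0 * \<mu> ^ n * (\<mu> ^ (m + 1) * W r * s' * entry (n - 1) (n + m) - W n * s * entry r (n - 1))
      = W 0 * \<mu> ^ n * (W n * a * entry r (n - 2) - \<mu> ^ (m + 1) * W r * a * entry n (n + m))"
    by (simp only: key')
  also have "\<dots> = W n * a * \<mu> ^ n * (W 0 * entry r (n - 2))
      - \<mu> ^ (m + 1) * W r * a * (W 0 * \<mu> ^ n * entry n (n + m))"
    by (simp only: right_diff_distrib mult_ac)
  also have "W n * a * \<mu> ^ n * (W 0 * entry r (n - 2))
      = W n * a * \<mu> ^ (m + 2) * (W 0 * \<mu> ^ r * entry r (n - 2))"
  proof -
    have "\<mu> ^ n = \<mu> ^ (m + 2) * \<mu> ^ r" by (simp add: r power_add mult_ac)
    then show ?thesis by (simp only: mult_ac)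
  qed
  also have "W n * a * \<mu> ^ (m + 2) * (W 0 * \<mu> ^ r * entry r (n - 2))
      - \<mu> ^ (m + 1) * W r * a * (W 0 * \<mu> ^ n * entry n (n + m))
      = W n * W r * a * entry 0 m * \<mu> ^ (m + 1) * (\<mu> - 1)"
    unfolding d1 d2 by (simp add: algebra_simps)
  finally show ?thesis by (simp add: W_def a_def s_def s'_def)
qed

text \<open>In \<open>jump_relation\<close> the left side decreases at most exponentially in \<open>n\<close>, while the right side
  is bounded by an exponential times the larger of the two weights next to the jump.\<close>

lemma multiplier_eq_1:
  assumes "entry 0 m \<noteq> 0"
  shows "\<mu> = 1"
proof (rule ccontr)
  assume "\<mu> \<noteq> 1"
  obtain C where C: "C > 0" "\<And>x. norm (X x) \<le> norm x * C" using X.pos_bounded by blast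
  have entry_le: "cmod (entry i j) \<le> C" for i j
    using order_trans[OF f_bound C(2)[of "e j"], of i] by (simp add: entry_def norm_e)
  define L where "L = max 1 (cmod \<mu>)"
  have L: "L \<ge> 1" "cmod \<mu> \<le> L" by (auto simp: L_def)
  define c where "c = cmod (entry 0 m) * cmod \<mu> ^ (m + 1) * cmod (\<mu> - 1)"
  have "c > 0" using assms nonzero \<open>\<mu> \<noteq> 1\<close> by (simp add: c_def)
  \<comment> \<open>The powers of 2 absorb the lower bounds \<open>(1/2) ^ ((n + m) * m)\<close> for two products of \<open>m\<close> weights
    and the jump weight \<open>(1/2) ^ n\<close>.\<close>
  define B where "B = 2 ^ (2 * m + 1) * L"
  define K where "K = C * (L ^ (m + 1) + 1) * 2 ^ (2 * m * m)"
  have bound: "c \<le> K * (B ^ n * (1/2) ^ (n - 1)\<^sup>2)" if n: "jump n" "4 * (m + 2) \<le> n" for n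
  proof -
    obtain r where r: "n = r + m + 2"
      using n(2) le_Suc_ex[of "m + 2" n] by (auto simp: algebra_simps)
    note near = not_jump_near_jump[OF n]
    define h :: real where "h = (1/2) ^ (n - 1)\<^sup>2"
    have small: "shift_weight (n - 1) \<le> h" "shift_weight n \<le> h"
    proof -
      show "shift_weight (n - 1) \<le> h" using n by (simp add: shift_weight_def h_def)
      have "(n - 1)\<^sup>2 \<le> n\<^sup>2" by (intro power_mono) auto
      then show "shift_weight n \<le> h"
        using n by (auto simp: shift_weight_def h_def intro!: power_decreasing)
    qed
    have "(1/2) ^ ((n + m) * m) \<le> weight_prod m n" "(1/2) ^ ((n + m) * m) \<le> weight_prod m r"
      using near r by (intro weight_prod_ge; force)+
    then have "(1/2) ^ ((n + m) * m) * (1/2) ^ ((n + m) * m) * (1/2) ^ n * c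
        \<le> weight_prod m n * weight_prod m r * jump_weight n * c"
      using n \<open>c > 0\<close> weight_prod_pos[of m]
      by (intro mult_right_mono mult_mono) (auto simp: jump_weight_def less_imp_le)
    also have "\<dots> = cmod (weight_prod m n * weight_prod m r * jump_weight n * entry 0 m * \<mu> ^ (m + 1) * (\<mu> - 1))"
      using weight_prod_pos[of m] n
      by (simp add: norm_mult norm_power c_def abs_of_pos jump_weight_def)
    also have "\<dots> = weight_prod m 0 * cmod \<mu> ^ n *
        cmod (\<mu> ^ (m + 1) * weight_prod m r * shift_weight (n - 1) * entry (n - 1) (n + m)
          - weight_prod m n * shift_weight n * entry r (n - 1))"
      unfolding jump_relation[OF n r] using weight_prod_pos[of m 0]
      by (simp add: norm_mult norm_power abs_of_pos)
    also have "\<dots> \<le> 1 * L ^ n * (L ^ (m + 1) * 1 * h * C + 1 * h * C)"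
    proof (intro mult_mono order_trans[OF norm_triangle_ineq4] add_mono)
      show "cmod (\<mu> ^ (m + 1) * weight_prod m r * shift_weight (n - 1) * entry (n - 1) (n + m))
          \<le> L ^ (m + 1) * 1 * h * C"
        unfolding norm_mult norm_power norm_of_real
        using L C(1) weight_prod_pos[of m r] weight_prod_le_1 shift_weight_nonneg small entry_le
        by (intro mult_mono power_mono) (auto simp: h_def)
      show "cmod (weight_prod m n * shift_weight n * entry r (n - 1)) \<le> 1 * h * C"
        unfolding norm_mult norm_of_real abs_mult
        using C(1) weight_prod_pos[of m n] weight_prod_le_1 shift_weight_nonneg small entry_le
        by (intro mult_mono) (auto simp: h_def)
    qed (use L weight_prod_le_1 C(1) in \<open>auto intro!: power_mono simp: h_def\<close>)
    also have "\<dots> = L ^ n * (C * (L ^ (m + 1) + 1)) * h" by (simp add: algebra_simps)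
    finally have "(2 ^ ((n + m) * m) * 2 ^ ((n + m) * m) * 2 ^ n) *
        ((1/2) ^ ((n + m) * m) * (1/2) ^ ((n + m) * m) * (1/2) ^ n * c)
        \<le> (2 ^ ((n + m) * m) * 2 ^ ((n + m) * m) * 2 ^ n) * (L ^ n * (C * (L ^ (m + 1) + 1)) * h)"
      by (intro mult_left_mono) auto
    also have "(2 ^ ((n + m) * m) * 2 ^ ((n + m) * m) * 2 ^ n) *
        ((1/2) ^ ((n + m) * m) * (1/2) ^ ((n + m) * m) * (1/2) ^ n * c) = c"
      by (simp add: power_one_over)
    also have "2 ^ ((n + m) * m) * 2 ^ ((n + m) * m) * 2 ^ n = (2 ^ (2 * m * m) * (2 ^ (2 * m + 1)) ^ n :: real)"
      unfolding power_add[symmetric] power_mult[symmetric] by (simp add: algebra_simps)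
    finally show ?thesis by (simp add: B_def K_def h_def power_mult_distrib mult_ac)
  qed
  have "(\<lambda>n. K * (B ^ n * (1/2) ^ (n - 1)\<^sup>2)) \<longlonglongrightarrow> K * 0"
    using L by (intro tendsto_mult_left power_mult_half_power_square_tendsto_0) (simp add: B_def)
  then have "\<forall>\<^sub>F n in sequentially. K * (B ^ n * (1/2) ^ (n - 1)\<^sup>2) < c"
    using \<open>c > 0\<close> by (intro order_tendstoD(2)[where y = "K * 0"]) auto
  then obtain N where N: "\<And>n. n \<ge> N \<Longrightarrow> K * (B ^ n * (1/2) ^ (n - 1)\<^sup>2) < c"
    by (auto simp: eventually_sequentially)
  obtain n where "n \<ge> max N (4 * (m + 2))" "jump n" using exists_large_jump by blast
  then show False using bound[of n] N[of n] by simp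
qed

end

theorem intertwiner_rigid:
  assumes "X \<noteq> (\<lambda>_. 0)"
  shows "\<mu> = 1"
proof -
  have nz: "\<mu> \<noteq> 0" using eq_0_if_multiplier_0 assms by (auto simp: fun_eq_iff)
  have ex: "\<exists>j. X (e j) \<noteq> 0"
    using operator_eq_0_if_eq_0_on_basis[OF X] assms by (auto simp: fun_eq_iff)
  define m where "m = (LEAST j. X (e j) \<noteq> 0)"
  have m: "X (e m) \<noteq> 0" "\<And>j. j < m \<Longrightarrow> X (e j) = 0"
    unfolding m_def using LeastI_ex[OF ex] not_less_Least by auto
  have "entry 0 m \<noteq> 0"
  proof
    assume "entry 0 m = 0"
    then have "entry i m = 0" for i
      using entry_eq_0[OF nz m(2), where r = 0] by (cases "i = 0") auto
    then have "X (e m) = 0"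
      by (intro eq_0_if_coordinates_eq_0) (simp add: entry_def coord_def)
    with m(1) show False ..
  qed
  with multiplier_eq_1[OF nz m(2)] show ?thesis by blast
qed

end

theorem theorem1p1:
  assumes "separable_space (euclidean :: 'a::chilbert_space topology)"
    and "\<not> finite_cdim (UNIV :: 'a set)"
  shows "\<exists>T :: 'a \<Rightarrow> 'a. bounded_clinear T \<and> compact_operator T \<and> quasinilpotent T \<and>
           extended_eigenvalues T = {1}"
proof -
  obtain e :: "nat \<Rightarrow> 'a" where "orthonormal_basis e"
    using exists_orthonormal_basis[OF assms] by blast
  then interpret orthonormal_basis e .
  have "\<mu> = 1" if ev: "extended_eigenvalue T \<mu>" for \<mu>
  proof -
    obtain X where Y: "bounded_clinear X" "X \<noteq> (\<lambda>_. 0)" "X \<circ> T = (\<lambda>x. \<mu> *\<^sub>C T (X x))"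
      using ev unfolding extended_eigenvalue_def by blast
    have "X (T x) = \<mu> *\<^sub>C T (X x)" for x using fun_cong[OF Y(3), of x] by simp
    with Y(1) interpret intertwiner e X \<mu> by unfold_locales
    show ?thesis using Y(2) by (rule intertwiner_rigid)
  qed
  moreover have "extended_eigenvalue T 1"
    unfolding extended_eigenvalue_def
  proof (intro exI[of _ "\<lambda>x. x"] conjI bounded_clinear_id)
    show "(\<lambda>x :: 'a. x) \<noteq> (\<lambda>_. 0)"
      using norm_e[of 0] by (metis norm_zero zero_neq_one)
  qed (use complex_vector.scale_one in \<open>auto simp: fun_eq_iff\<close>)
  ultimately have "extended_eigenvalues T = {1}"
    by (auto simp: extended_eigenvalues_def)
  then show ?thesis using bounded_clinear_T compact_operator_T quasinilpotent_T by blast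
qed

end
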